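(* Let $H_k\in\mathbb{R}^{n\times n}$ be symmetric, $g_k\in\mathbb{R}^n$ and let $\Delta>0$ be any radius. There is a value $\delta_k\in\mathbb{R}$ such that the generalized homogeneous model $$\min_{\|[v;t]\|\le 1}\ [v;t]^T\begin{bmatrix}H_k & g_k\\ g_k^T & \delta_k\end{bmatrix}[v;t]$$ has an optimal solution $[v_k;t_k]$ with $t_k\ne0$ for which $d_k=v_k/t_k$ solves the trust-region subproblem $$\min_{\|d\|\le\Delta}\ m_k(d):=f(x_k)+g_k^Td+\tfrac12 d^TH_kd .$$ Furthermore, the number of inner iterations $\mathcal{T}_k$ (the number of generalized homogeneous models solved) for searching the desired $\delta_k$ is upper bounded by $O(\log(\epsilon^{-1}))$ via a bisection procedure over $\delta_k$.
   Context: Here $f:\mathbb{R}^n\to\mathbb{R}$ is twice differentiable, $x_k$ is the current iterate, $g_k=\nabla f(x_k)$, $H_k=\nabla^2 f(x_k)$; $v\in\mathbb{R}^n$, $t\in\mathbb{R}$, and $\|\cdot\|$ is the Euclidean norm. $\epsilon>0$ is the prescribed accuracy to which the desired $\delta_k$ is located, and the implied constant may depend on $H_k,g_k,\Delta$ but not on $\epsilon$. A bisection procedure starts from an interval containing the desired $\delta_k$ and at each step halves the interval after solving one generalized homogeneous model at the midpoint. *)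

theory Defs
  imports "HOL-Analysis.Analysis" "HOL-Library.Landau_Symbols"
begin

text \<open>
  The stacked vector $[v;t]$ lives in the Euclidean space indexed by \<^typ>\<open>'n + unit\<close>:
  \<open>Inl i\<close> are the coordinates of \<open>v\<close> and \<open>Inr ()\<close> is the homogenizing coordinate \<open>t\<close>.
\<close>

definition stack :: "real ^ 'n \<Rightarrow> real \<Rightarrow> real ^ ('n + unit)" where
  "stack v t = (\<chi> i. case i of Inl a \<Rightarrow> v $ a | Inr _ \<Rightarrow> t)"

definition ghm_matrix ::
    "real ^ 'n ^ 'n \<Rightarrow> real ^ 'n \<Rightarrow> real \<Rightarrow> real ^ ('n + unit) ^ ('n + unit)" where
  "ghm_matrix H g \<delta> = (\<chi> i j. case i of
      Inl a \<Rightarrow> (case j of Inl b \<Rightarrow> H $ a $ b | Inr _ \<Rightarrow> g $ a)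
    | Inr _ \<Rightarrow> (case j of Inl b \<Rightarrow> g $ b | Inr _ \<Rightarrow> \<delta>))"

definition ghm_solution ::
    "real ^ 'n ^ 'n \<Rightarrow> real ^ 'n \<Rightarrow> real \<Rightarrow> real ^ 'n \<Rightarrow> real \<Rightarrow> bool" where
  "ghm_solution H g \<delta> v t \<longleftrightarrow>
    is_arg_min (\<lambda>z. z \<bullet> (ghm_matrix H g \<delta> *v z)) (\<lambda>z. norm z \<le> 1) (stack v t)"

definition tr_model ::
    "(real ^ 'n \<Rightarrow> real) \<Rightarrow> real ^ 'n \<Rightarrow> real ^ 'n ^ 'n \<Rightarrow> real ^ 'n \<Rightarrow> real ^ 'n \<Rightarrow> real" where
  "tr_model f x H g d = f x + g \<bullet> d + 1 / 2 * (d \<bullet> (H *v d))"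

definition trs_solution ::
    "(real ^ 'n \<Rightarrow> real) \<Rightarrow> real ^ 'n \<Rightarrow> real ^ 'n ^ 'n \<Rightarrow> real ^ 'n \<Rightarrow> real \<Rightarrow> real ^ 'n \<Rightarrow> bool" where
  "trs_solution f x H g \<Delta> d \<longleftrightarrow> is_arg_min (tr_model f x H g) (\<lambda>d. norm d \<le> \<Delta>) d"

text \<open>
  The values of \<open>\<delta>\<close> that are searched for. The value is unique except when \<open>g = 0\<close> and \<open>H\<close> is
  positive semidefinite, where every \<open>\<delta> \<le> 0\<close> qualifies.
\<close>

definition desired ::
    "(real ^ 'n \<Rightarrow> real) \<Rightarrow> real ^ 'n \<Rightarrow> real ^ 'n ^ 'n \<Rightarrow> real ^ 'n \<Rightarrow> real \<Rightarrow> real \<Rightarrow> bool" where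
  "desired f x H g \<Delta> \<delta> \<longleftrightarrow>
    (\<exists>v t. ghm_solution H g \<delta> v t \<and> t \<noteq> 0 \<and> trs_solution f x H g \<Delta> (v /\<^sub>R t))"

text \<open>
  A solver returns some optimal solution $[v;t]$ of the model for each \<open>\<delta>\<close>. Optimal solutions need
  not be unique, and nothing is assumed about which one is returned.
\<close>

definition ghm_solver ::
    "real ^ 'n ^ 'n \<Rightarrow> real ^ 'n \<Rightarrow> (real \<Rightarrow> (real ^ 'n) \<times> real) \<Rightarrow> bool" where
  "ghm_solver H g sol \<longleftrightarrow> (\<forall>\<delta>. ghm_solution H g \<delta> (fst (sol \<delta>)) (snd (sol \<delta>)))"

text \<open>
  One inner iteration: one model is solved at the midpoint, and only the returned solution decides
  which half is kept. The length of $v/t$ grows with \<open>\<delta>\<close> (\<open>t = 0\<close> counting as infinitely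
  long), so the upper half is kept exactly if $v/t$ exists and lies in the trust region.
\<close>

definition bisect_step ::
    "(real \<Rightarrow> (real ^ 'n) \<times> real) \<Rightarrow> real \<Rightarrow> real \<times> real \<Rightarrow> real \<times> real" where
  "bisect_step sol \<Delta> = (\<lambda>(lo, hi).
     let \<delta> = (lo + hi) / 2; (v, t) = sol \<delta>
     in if t \<noteq> 0 \<and> norm (v /\<^sub>R t) \<le> \<Delta> then (\<delta>, hi) else (lo, \<delta>))"

definition bracket ::
    "(real \<Rightarrow> (real ^ 'n) \<times> real) \<Rightarrow> real \<Rightarrow> real \<Rightarrow> real \<Rightarrow> nat \<Rightarrow> real \<times> real" where
  "bracket sol \<Delta> lo hi k = (bisect_step sol \<Delta> ^^ k) (lo, hi)"

definition short_enough ::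
    "(real \<Rightarrow> (real ^ 'n) \<times> real) \<Rightarrow> real \<Rightarrow> real \<Rightarrow> real \<Rightarrow> real \<Rightarrow> nat \<Rightarrow> bool" where
  "short_enough sol \<Delta> lo hi \<epsilon> k \<longleftrightarrow>
    snd (bracket sol \<Delta> lo hi k) - fst (bracket sol \<Delta> lo hi k) \<le> \<epsilon>"

text \<open>
  The number of models solved until the bracket has length at most \<open>\<epsilon>\<close>. \<open>LEAST\<close> is
  only meaningful together with the fact that such an iteration exists.
\<close>

definition inner_iterations ::
    "(real \<Rightarrow> (real ^ 'n) \<times> real) \<Rightarrow> real \<Rightarrow> real \<Rightarrow> real \<Rightarrow> real \<Rightarrow> nat" where
  "inner_iterations sol \<Delta> lo hi \<epsilon> = (LEAST k. short_enough sol \<Delta> lo hi \<epsilon> k)"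

end

theory Submission imports Defs begin

text \<open>
  Everything rests on one necessary optimality condition. A minimizer \<open>x\<close> of a quadratic function
  with Hessian \<open>A\<close> and linear part \<open>b\<close> over a ball has a multiplier \<open>\<theta> \<ge> 0\<close> for which
  \<open>A + \<theta> I\<close> is positive semidefinite and \<open>(A + \<theta> I) x = - b\<close>, and \<open>\<theta> = 0\<close> unless \<open>x\<close> lies on
  the sphere (\<open>ball_minimizer_multiplier\<close>). It applies both to the trust-region subproblem, with
  \<open>A = H\<close> and \<open>b = g\<close>, and to the homogeneous model, where \<open>A\<close> is the bordered matrix \<open>F\<close> with
  corner \<open>\<delta>\<close>, \<open>b = 0\<close> and the radius is 1.

  Existence of the desired \<open>\<delta>\<close>: the subproblem has a solution \<open>d\<close> by compactness; let \<open>\<theta>\<close> be its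
  multiplier. The choice \<open>\<delta> = - \<theta> - g \<bullet> d\<close> puts \<open>[d; 1]\<close> into the kernel of \<open>F + \<theta> I\<close>, and
  this matrix is positive semidefinite because its quadratic form at \<open>[u + s d; s]\<close> is that of
  \<open>H + \<theta> I\<close> at \<open>u\<close>. Hence \<open>[d; 1]\<close>, scaled to length 1, solves the model.

  Bisection works although nothing is assumed about which optimal solution the solver returns,
  because of two monotonicity facts. The multiplier of the model strictly decreases as \<open>\<delta>\<close> grows,
  provided that the solution at the larger \<open>\<delta>\<close> has \<open>t \<noteq> 0\<close> (\<open>multiplier_strict_antimono\<close>). And
  \<open>d = v / t\<close> minimizes \<open>g \<bullet> d + d \<bullet> H d / 2 + \<theta> \<parallel>d\<parallel>\<^sup>2 / 2\<close> over the whole space, so a smaller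
  \<open>\<theta>\<close> comes with a \<open>d\<close> that is at least as long (\<open>norm_antimono_multiplier\<close>). Consequently below a desired value every
  returned direction exists and lies in the trust region, so the upper half is kept. If a direction
  in the trust region is returned above a desired value, then it is at least as long as the
  trust-region solution at hand and cannot have a larger model value, so the midpoint is itself
  desired. As the midpoint belongs to both halves, a desired value always survives. The
  interval halves each time, which gives the logarithmic count.
\<close>

section \<open>Quadratic functions on a ball\<close>

definition quad :: "real ^ 'm ^ 'm \<Rightarrow> real ^ 'm \<Rightarrow> real ^ 'm \<Rightarrow> real" where
  "quad A b x = b \<bullet> x + 1 / 2 * (x \<bullet> (A *v x))"

text \<open>
  The Lagrange multiplier of the constraint on \<open>norm x\<close>, in the strong form that describes global
  minimizers. Complementary slackness is left out, as it is the only condition that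
  mentions the radius.
\<close>

definition multiplier :: "real ^ 'm ^ 'm \<Rightarrow> real ^ 'm \<Rightarrow> real ^ 'm \<Rightarrow> real \<Rightarrow> bool" where
  "multiplier A b x \<theta> \<longleftrightarrow> \<theta> \<ge> 0 \<and> (\<forall>w. 0 \<le> w \<bullet> (A *v w) + \<theta> * (w \<bullet> w))
     \<and> A *v x + \<theta> *\<^sub>R x + b = 0"

lemma sym_form_commute:
  fixes A :: "real ^ 'm ^ 'm"
  assumes "transpose A = A"
  shows "x \<bullet> (A *v y) = y \<bullet> (A *v x)"
  using dot_lmul_matrix[of x A y] vector_transpose_matrix[of x A] assms
  by (metis inner_commute)

lemma quad_add:
  fixes A :: "real ^ 'm ^ 'm"
  assumes "transpose A = A"
  shows "quad A b (x + w) = quad A b x + (A *v x + b) \<bullet> w + 1 / 2 * (w \<bullet> (A *v w))"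
  using sym_form_commute[OF assms, of x w]
  by (simp add: quad_def matrix_vector_right_distrib inner_add_left inner_add_right inner_commute
      algebra_simps)

text \<open>
  Inequalities that first hold only off a critical hyperplane or for small positive steps pass to
  the limit by this lemma.
\<close>

lemma nonneg_if_perturbed_nonneg:
  fixes a b c e :: real
  assumes "e > 0" "\<And>\<eta>. 0 < \<eta> \<Longrightarrow> \<eta> < e \<Longrightarrow> 0 \<le> a + \<eta> * b + \<eta>\<^sup>2 * c"
  shows "0 \<le> a"
proof (rule tendsto_lowerbound)
  show "((\<lambda>\<eta>. a + \<eta> * b + \<eta>\<^sup>2 * c) \<longlongrightarrow> a) (at_right 0)"
    by (auto intro!: tendsto_eq_intros)
  show "\<forall>\<^sub>F \<eta> in at_right 0. 0 \<le> a + \<eta> * b + \<eta>\<^sup>2 * c"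
    using eventually_at_right_real[OF assms(1)] assms(2) by (auto elim!: eventually_mono)
qed simp

text \<open>
  In the interior, short steps in every direction are feasible, and the unconstrained conditions hold
  with \<open>\<theta> = 0\<close>. On the
  sphere, the gradient \<open>p\<close> has a nonnegative slope along every inward direction, hence along every
  tangent one, so \<open>p = - \<theta> x\<close> with \<open>\<theta> \<ge> 0\<close>. For the curvature, every line through \<open>x\<close> that is not
  tangent meets the sphere in a second point. Comparing the values at both points leaves only
  the form of \<open>A + \<theta> I\<close> in the direction of the line. Tangent directions follow by a limit.
\<close>

lemma ball_minimizer_multiplier:
  fixes A :: "real ^ 'm ^ 'm"
  assumes sym: "transpose A = A" and r: "r > 0" and x: "norm x \<le> r"
    and min: "\<And>y. norm y \<le> r \<Longrightarrow> quad A b x \<le> quad A b y"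
  obtains \<theta> where "multiplier A b x \<theta>" "\<theta> = 0 \<or> norm x = r"
proof -
  define p where "p = A *v x + b"
  have step: "0 \<le> s * (p \<bullet> w) + s\<^sup>2 / 2 * (w \<bullet> (A *v w))" if "norm (x + s *\<^sub>R w) \<le> r" for s w
    using min[OF that] quad_add[OF sym, of b x "s *\<^sub>R w"]
    by (simp add: p_def matrix_vector_mult_scaleR power2_eq_square)
  have slope: "0 \<le> p \<bullet> w"
    if e: "e > 0" and feas: "\<And>s. 0 < s \<Longrightarrow> s < e \<Longrightarrow> norm (x + s *\<^sub>R w) \<le> r" for w e
  proof (rule nonneg_if_perturbed_nonneg[OF e, where b = "w \<bullet> (A *v w) / 2" and c = 0])
    fix s :: real assume s: "0 < s" "s < e"
    have "0 \<le> s * (p \<bullet> w + s * (w \<bullet> (A *v w) / 2))"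
      using step[OF feas[OF s]] by (simp add: algebra_simps power2_eq_square)
    then show "0 \<le> p \<bullet> w + s * (w \<bullet> (A *v w) / 2) + s\<^sup>2 * 0"
      using s by (simp add: zero_le_mult_iff)
  qed
  show thesis
  proof (cases "norm x < r")
    case True
    \<comment> \<open>The \<open>+ 1\<close> only keeps the step bound defined for \<open>w = 0\<close>.\<close>
    have feas: "norm (x + s *\<^sub>R w) \<le> r" if "0 < s" "s < (r - norm x) / (norm w + 1)" for s w
    proof -
      have "s * norm w \<le> s * (norm w + 1)" using that by simp
      also have "\<dots> < r - norm x"
        using that(2) by (simp add: pos_less_divide_eq add_nonneg_pos)
      finally show ?thesis using norm_triangle_ineq[of x "s *\<^sub>R w"] that(1) by simp
    qed
    have epos: "(r - norm x) / (norm w + 1) > 0" for w :: "real ^ 'm"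
      using True by (simp add: add_nonneg_pos)
    have "0 \<le> p \<bullet> (- p)" by (rule slope[OF epos feas])
    then have p0: "p = 0" using inner_gt_zero_iff[of p] by fastforce
    have "0 \<le> w \<bullet> (A *v w)" for w
    proof -
      obtain s where s: "0 < s" "s < (r - norm x) / (norm w + 1)"
        using dense[OF epos[of w]] by blast
      show ?thesis using step[OF feas[OF s]] s(1) p0 by (simp add: zero_le_mult_iff)
    qed
    then have "multiplier A b x 0" using p0 by (simp add: multiplier_def p_def)
    then show thesis using that by blast
  next
    case False
    then have xr: "norm x = r" using x by simp
    then have xx: "x \<bullet> x > 0" using r by auto
    have inward: "0 \<le> p \<bullet> w" if wx: "w \<bullet> x < 0" for w
    proof (rule slope)
      have ww: "w \<bullet> w > 0" using wx by auto
      show "- 2 * (w \<bullet> x) / (w \<bullet> w) > 0" using wx ww by (simp add: divide_neg_pos)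
      fix s assume s: "0 < s" "s < - 2 * (w \<bullet> x) / (w \<bullet> w)"
      have "s * (w \<bullet> w) < - 2 * (w \<bullet> x)" using s(2) unfolding pos_less_divide_eq[OF ww] .
      then have "s * (2 * (w \<bullet> x) + s * (w \<bullet> w)) \<le> 0" using s(1) by (simp add: mult_le_0_iff)
      then have "(norm (x + s *\<^sub>R w))\<^sup>2 \<le> (norm x)\<^sup>2"
        by (simp add: power2_norm_eq_inner inner_add_left inner_add_right inner_commute algebra_simps)
      then show "norm (x + s *\<^sub>R w) \<le> r" using xr power2_le_imp_le[OF _ norm_ge_zero] by metis
    qed
    have tangent: "0 \<le> p \<bullet> w" if wx: "w \<bullet> x = 0" for w
    proof (rule nonneg_if_perturbed_nonneg[OF zero_less_one, where b = "- (p \<bullet> x)" and c = 0])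
      fix \<eta> :: real assume \<eta>: "0 < \<eta>"
      have "0 \<le> p \<bullet> (w - \<eta> *\<^sub>R x)"
        using \<eta> xx wx by (intro inward) (simp add: inner_diff_left)
      then show "0 \<le> p \<bullet> w + \<eta> * - (p \<bullet> x) + \<eta>\<^sup>2 * 0" by (simp add: inner_diff_right)
    qed
    \<comment> \<open>This value makes \<open>p + \<theta> x\<close> tangent to the sphere.\<close>
    define \<theta> where "\<theta> = - (p \<bullet> x) / (x \<bullet> x)"
    have \<theta>0: "\<theta> \<ge> 0"
      unfolding \<theta>_def using inward[of "- x"] xx by (intro divide_nonneg_pos) simp_all
    define u where "u = p + \<theta> *\<^sub>R x"
    have ux: "u \<bullet> x = 0" using xx by (simp add: u_def \<theta>_def inner_diff_left)
    have "0 \<le> p \<bullet> (- u)" using ux by (intro tangent) simp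
    moreover have "p \<bullet> u = u \<bullet> u"
    proof -
      have "p \<bullet> u = (u - \<theta> *\<^sub>R x) \<bullet> u" by (simp add: u_def)
      also have "\<dots> = u \<bullet> u" using ux by (simp add: inner_diff_left inner_commute[of x u])
      finally show ?thesis .
    qed
    ultimately have u0: "u = 0" using inner_gt_zero_iff[of u] by fastforce
    then have p: "p = - (\<theta> *\<^sub>R x)" by (simp add: u_def eq_neg_iff_add_eq_0)
    define Q where "Q = (\<lambda>w. w \<bullet> (A *v w) + \<theta> * (w \<bullet> w))"
    have transversal: "0 \<le> Q w" if wx: "w \<bullet> x \<noteq> 0" for w
    proof -
      have ww: "w \<bullet> w > 0" using wx by auto
      \<comment> \<open>At this step length the line meets the sphere for the second time.\<close>
      define s where "s = - 2 * (w \<bullet> x) / (w \<bullet> w)"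
      have s0: "s \<noteq> 0" using wx ww by (simp add: s_def)
      have s: "s * (w \<bullet> w) = - 2 * (w \<bullet> x)" using ww by (simp add: s_def)
      then have "(norm (x + s *\<^sub>R w))\<^sup>2 = (norm x)\<^sup>2"
        by (simp add: power2_norm_eq_inner inner_add_left inner_add_right inner_commute algebra_simps)
      then have "norm (x + s *\<^sub>R w) = r" using xr power2_eq_iff_nonneg[OF norm_ge_zero norm_ge_zero] by metis
      then have "0 \<le> s * (p \<bullet> w) + s\<^sup>2 / 2 * (w \<bullet> (A *v w))" using step by simp
      also have "s * (p \<bullet> w) = \<theta> * s / 2 * (- 2 * (w \<bullet> x))" by (simp add: p inner_commute)
      also have "\<dots> = \<theta> * s / 2 * (s * (w \<bullet> w))" by (simp only: s)
      finally have "0 \<le> s\<^sup>2 * Q w" by (simp add: Q_def power2_eq_square algebra_simps)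
      then show ?thesis using s0 by (simp add: zero_le_mult_iff)
    qed
    have "0 \<le> Q w" for w
    proof (cases "w \<bullet> x = 0")
      case wx: True
      show ?thesis
      proof (rule nonneg_if_perturbed_nonneg[OF zero_less_one, where
            b = "2 * (w \<bullet> (A *v x) + \<theta> * (w \<bullet> x))" and c = "Q x"])
        fix \<eta> :: real assume \<eta>: "0 < \<eta>"
        have "0 \<le> Q (w + \<eta> *\<^sub>R x)"
          using \<eta> xx wx by (intro transversal) (simp add: inner_add_left)
        also have "\<dots> = Q w + \<eta> * (2 * (w \<bullet> (A *v x) + \<theta> * (w \<bullet> x))) + \<eta>\<^sup>2 * Q x"
          using sym_form_commute[OF sym, of x w]
          by (simp add: Q_def matrix_vector_right_distrib matrix_vector_mult_scaleR inner_add_left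
              inner_add_right inner_commute power2_eq_square algebra_simps)
        finally show "0 \<le> Q w + \<eta> * (2 * (w \<bullet> (A *v x) + \<theta> * (w \<bullet> x))) + \<eta>\<^sup>2 * Q x" .
      qed
    qed (rule transversal)
    then have "multiplier A b x \<theta>"
      using \<theta>0 u0 by (simp add: multiplier_def u_def p_def Q_def algebra_simps)
    then show thesis using that xr by blast
  qed
qed

text \<open>
  The penalized function has gradient 0 at \<open>x\<close> and the positive semidefinite Hessian
  \<open>A + \<theta> I\<close>, so it is convex.
\<close>

lemma multiplier_minimizes_penalized:
  fixes A :: "real ^ 'm ^ 'm"
  assumes sym: "transpose A = A" and m: "multiplier A b x \<theta>"
  shows "quad A b x + \<theta> / 2 * (norm x)\<^sup>2 \<le> quad A b y + \<theta> / 2 * (norm y)\<^sup>2"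
proof -
  define w where "w = y - x"
  have y: "y = x + w" by (simp add: w_def)
  have "A *v x + b = - (\<theta> *\<^sub>R x)" using m by (simp add: multiplier_def eq_neg_iff_add_eq_0 algebra_simps)
  then have "quad A b y = quad A b x - \<theta> * (x \<bullet> w) + 1 / 2 * (w \<bullet> (A *v w))"
    by (simp add: y quad_add[OF sym])
  moreover have "(norm y)\<^sup>2 = (norm x)\<^sup>2 + 2 * (x \<bullet> w) + w \<bullet> w"
    by (simp add: y power2_norm_eq_inner inner_add_left inner_add_right inner_commute)
  moreover have "0 \<le> w \<bullet> (A *v w) + \<theta> * (w \<bullet> w)" using m by (simp add: multiplier_def)
  ultimately show ?thesis by (simp add: algebra_simps)
qed

text \<open>
  Adding the minimality of \<open>x\<^sub>1\<close> and of \<open>x\<^sub>2\<close> for their own penalties, each tested at the other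
  point, cancels the quadratic function and leaves only the penalties.
\<close>

lemma norm_antimono_multiplier:
  fixes A :: "real ^ 'm ^ 'm"
  assumes sym: "transpose A = A" and 1: "multiplier A b x\<^sub>1 \<theta>\<^sub>1" and 2: "multiplier A b x\<^sub>2 \<theta>\<^sub>2"
    and less: "\<theta>\<^sub>2 < \<theta>\<^sub>1"
  shows "norm x\<^sub>1 \<le> norm x\<^sub>2"
proof -
  have "(\<theta>\<^sub>1 - \<theta>\<^sub>2) * ((norm x\<^sub>1)\<^sup>2 - (norm x\<^sub>2)\<^sup>2) \<le> 0"
    using multiplier_minimizes_penalized[OF sym 1, of x\<^sub>2]
      multiplier_minimizes_penalized[OF sym 2, of x\<^sub>1]
    by (simp add: algebra_simps)
  then have "(norm x\<^sub>1)\<^sup>2 \<le> (norm x\<^sub>2)\<^sup>2" using less by (simp add: mult_le_0_iff)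
  then show ?thesis by (rule power2_le_imp_le) simp
qed

section \<open>The homogeneous model in block form\<close>

lemma sum_UNIV_plus_unit:
  fixes h :: "'n::finite + unit \<Rightarrow> real"
  shows "sum h UNIV = (\<Sum>i\<in>UNIV. h (Inl i)) + h (Inr ())"
  by (simp add: UNIV_Plus_UNIV[symmetric] sum.Plus UNIV_unit del: UNIV_Plus_UNIV)

lemma stack_cases:
  obtains v t where "z = stack v t"
proof
  show "z = stack (\<chi> i. z $ Inl i) (z $ Inr ())"
    by (auto simp: stack_def vec_eq_iff split: sum.split)
qed

lemma stack_arith:
  "stack v t + stack w s = stack (v + w) (t + s)"
  "c *\<^sub>R stack v t = stack (c *\<^sub>R v) (c * t)"
  by (auto simp: stack_def vec_eq_iff split: sum.split)

lemma stack_eq_0_iff: "stack v t = 0 \<longleftrightarrow> v = 0 \<and> t = 0"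
  by (auto simp: stack_def vec_eq_iff split: sum.split)

lemma inner_stack: "stack v t \<bullet> stack w s = v \<bullet> w + t * s"
  by (simp add: stack_def inner_vec_def sum_UNIV_plus_unit)

lemma ghm_matrix_stack:
  "ghm_matrix H g \<delta> *v stack v t = stack (H *v v + t *\<^sub>R g) (g \<bullet> v + \<delta> * t)"
  by (auto simp: ghm_matrix_def stack_def vec_eq_iff matrix_vector_mult_def sum_UNIV_plus_unit
      inner_vec_def split: sum.split)

lemma transpose_ghm_matrix:
  assumes "transpose H = H"
  shows "transpose (ghm_matrix H g \<delta>) = ghm_matrix H g \<delta>"
proof -
  have "H $ i $ j = H $ j $ i" for i j
    using assms by (metis transpose_def vec_lambda_beta)
  then show ?thesis
    by (auto simp: ghm_matrix_def transpose_def vec_eq_iff split: sum.split)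
qed

lemma ghm_form_stack:
  "stack v t \<bullet> (ghm_matrix H g \<delta> *v stack v t)
    = v \<bullet> (H *v v) + 2 * t * (g \<bullet> v) + \<delta> * t\<^sup>2"
  by (simp add: ghm_matrix_stack inner_stack inner_add_right inner_commute power2_eq_square
      algebra_simps)

lemma ghm_multiplier_stack:
  "multiplier (ghm_matrix H g \<delta>) 0 (stack v t) \<theta> \<longleftrightarrow>
    \<theta> \<ge> 0 \<and>
    (\<forall>w s. 0 \<le> w \<bullet> (H *v w) + 2 * s * (g \<bullet> w) + \<delta> * s\<^sup>2 + \<theta> * (w \<bullet> w + s\<^sup>2)) \<and>
    H *v v + \<theta> *\<^sub>R v + t *\<^sub>R g = 0 \<and> g \<bullet> v + (\<delta> + \<theta>) * t = 0"
proof -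
  have *: "(\<forall>z. P z) \<longleftrightarrow> (\<forall>w s. P (stack w s))" for P :: "real ^ ('n::finite + unit) \<Rightarrow> bool"
    by (metis stack_cases)
  show ?thesis
    unfolding multiplier_def * ghm_form_stack
    unfolding inner_stack ghm_matrix_stack stack_arith stack_eq_0_iff add_0_right
    by (simp add: power2_eq_square algebra_simps)
qed

lemma ghm_solution_multiplier:
  assumes sym: "transpose H = H" and sol: "ghm_solution H g \<delta> v t"
  obtains \<theta> where "multiplier (ghm_matrix H g \<delta>) 0 (stack v t) \<theta>" "\<theta> = 0 \<or> norm (stack v t) = 1"
proof (rule ball_minimizer_multiplier[OF transpose_ghm_matrix[OF sym] zero_less_one])
  show "norm (stack v t) \<le> 1" using sol by (simp add: ghm_solution_def is_arg_min_def)
  show "quad (ghm_matrix H g \<delta>) 0 (stack v t) \<le> quad (ghm_matrix H g \<delta>) 0 y" if "norm y \<le> 1" for y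
    using sol that by (force simp: ghm_solution_def is_arg_min_def quad_def not_less)
qed (use that in blast)

text \<open>
  The form of \<open>F + \<theta>\<^sub>2 I\<close> vanishes at \<open>[v\<^sub>2; t\<^sub>2]\<close> for the corner \<open>\<delta>\<^sub>2\<close>. Lowering the corner to \<open>\<delta>\<^sub>1\<close>
  makes it negative there because \<open>t\<^sub>2 \<noteq> 0\<close>, and only a larger multiplier can restore
  nonnegativity. This holds for every solution, so the strictness does not rely on eigenvectors
  being unique.
\<close>

lemma multiplier_strict_antimono:
  assumes 1: "multiplier (ghm_matrix H g \<delta>\<^sub>1) 0 (stack v\<^sub>1 t\<^sub>1) \<theta>\<^sub>1"
    and 2: "multiplier (ghm_matrix H g \<delta>\<^sub>2) 0 (stack v\<^sub>2 t\<^sub>2) \<theta>\<^sub>2"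
    and t: "t\<^sub>2 \<noteq> 0" and less: "\<delta>\<^sub>1 < \<delta>\<^sub>2"
  shows "\<theta>\<^sub>2 < \<theta>\<^sub>1"
proof (rule ccontr)
  assume "\<not> \<theta>\<^sub>2 < \<theta>\<^sub>1"
  then have "\<theta>\<^sub>1 * (v\<^sub>2 \<bullet> v\<^sub>2 + t\<^sub>2\<^sup>2) \<le> \<theta>\<^sub>2 * (v\<^sub>2 \<bullet> v\<^sub>2 + t\<^sub>2\<^sup>2)"
    by (intro mult_right_mono) auto
  moreover have "\<delta>\<^sub>1 * t\<^sub>2\<^sup>2 < \<delta>\<^sub>2 * t\<^sub>2\<^sup>2" using less t by simp
  moreover have "0 \<le> v\<^sub>2 \<bullet> (H *v v\<^sub>2) + 2 * t\<^sub>2 * (g \<bullet> v\<^sub>2) + \<delta>\<^sub>1 * t\<^sub>2\<^sup>2 + \<theta>\<^sub>1 * (v\<^sub>2 \<bullet> v\<^sub>2 + t\<^sub>2\<^sup>2)"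
    using 1 by (simp add: ghm_multiplier_stack)
  moreover have "v\<^sub>2 \<bullet> (H *v v\<^sub>2) + 2 * t\<^sub>2 * (g \<bullet> v\<^sub>2) + \<delta>\<^sub>2 * t\<^sub>2\<^sup>2 + \<theta>\<^sub>2 * (v\<^sub>2 \<bullet> v\<^sub>2 + t\<^sub>2\<^sup>2) = 0"
  proof -
    have "v\<^sub>2 \<bullet> (H *v v\<^sub>2 + \<theta>\<^sub>2 *\<^sub>R v\<^sub>2 + t\<^sub>2 *\<^sub>R g) + t\<^sub>2 * (g \<bullet> v\<^sub>2 + (\<delta>\<^sub>2 + \<theta>\<^sub>2) * t\<^sub>2) = 0"
      using 2 by (simp add: ghm_multiplier_stack)
    then show ?thesis
      by (simp add: inner_add_right inner_commute power2_eq_square algebra_simps)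
  qed
  ultimately show False by linarith
qed

text \<open>
  Dividing the upper block of the kernel equation by \<open>t\<close> yields the stationarity condition of the
  subproblem, with the same multiplier.
\<close>

lemma ghm_multiplier_direction:
  assumes m: "multiplier (ghm_matrix H g \<delta>) 0 (stack v t) \<theta>" and t: "t \<noteq> 0"
  shows "multiplier H g (v /\<^sub>R t) \<theta>"
proof -
  have "0 \<le> w \<bullet> (H *v w) + \<theta> * (w \<bullet> w)" for w
  proof -
    have "0 \<le> w \<bullet> (H *v w) + 2 * 0 * (g \<bullet> w) + \<delta> * 0\<^sup>2 + \<theta> * (w \<bullet> w + 0\<^sup>2)"
      using m unfolding ghm_multiplier_stack by blast
    then show ?thesis by simp
  qed
  moreover have "H *v (v /\<^sub>R t) + \<theta> *\<^sub>R (v /\<^sub>R t) + g = 0"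
  proof -
    have "(1 / t) *\<^sub>R (H *v v + \<theta> *\<^sub>R v + t *\<^sub>R g) = 0" using m by (simp add: ghm_multiplier_stack)
    then show ?thesis using t
      by (simp add: matrix_vector_mult_scaleR scaleR_add_right divide_inverse mult.commute)
  qed
  ultimately show ?thesis using m by (simp add: multiplier_def)
qed

text \<open>
  On the unit ball the form of \<open>F\<close> is bounded below by \<open>- \<theta>\<close>, and a unit kernel vector of
  \<open>F + \<theta> I\<close> attains this bound.
\<close>

lemma ghm_solutionI:
  assumes m: "multiplier (ghm_matrix H g \<delta>) 0 (stack v t) \<theta>" and n: "norm (stack v t) = 1"
  shows "ghm_solution H g \<delta> v t"
proof -
  define F where "F = ghm_matrix H g \<delta>"
  have val: "stack v t \<bullet> (F *v stack v t) = - \<theta>"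
  proof -
    have "F *v stack v t = - (\<theta> *\<^sub>R stack v t)"
      using m by (simp add: multiplier_def F_def eq_neg_iff_add_eq_0)
    moreover have "stack v t \<bullet> stack v t = 1" using n by (simp add: norm_eq_1)
    ultimately show ?thesis by simp
  qed
  have "- \<theta> \<le> z \<bullet> (F *v z)" if "norm z \<le> 1" for z
  proof -
    have "z \<bullet> z \<le> 1" using that by (simp add: norm_le_square)
    then have "\<theta> * (z \<bullet> z) \<le> \<theta> * 1" using m by (intro mult_left_mono) (auto simp: multiplier_def)
    moreover have "0 \<le> z \<bullet> (F *v z) + \<theta> * (z \<bullet> z)" using m by (simp add: multiplier_def F_def)
    ultimately show ?thesis by linarith
  qed
  then show ?thesis using n val by (auto simp: ghm_solution_def is_arg_min_def F_def not_less)
qed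

section \<open>The desired value of \<open>\<delta>\<close>\<close>

lemma tr_model_eq_quad: "tr_model f x H g d = f x + quad H g d"
  by (simp add: tr_model_def quad_def)

lemma trs_solution_iff:
  "trs_solution f x H g \<Delta> d \<longleftrightarrow>
    norm d \<le> \<Delta> \<and> (\<forall>y. norm y \<le> \<Delta> \<longrightarrow> quad H g d \<le> quad H g y)"
  by (auto simp: trs_solution_def is_arg_min_def tr_model_eq_quad not_less)

text \<open>
  The value of \<open>\<delta>\<close> is forced by the last row of the kernel equation for \<open>[d; 1]\<close>.
\<close>

lemma desired_exists:
  assumes sym: "transpose H = H" and \<Delta>: "\<Delta> > 0"
  shows "\<exists>\<delta>. desired f x H g \<Delta> \<delta>"
proof -
  have "continuous_on (cball 0 \<Delta>) (quad H g)"
    unfolding quad_def by (intro continuous_intros)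
  then obtain d where d: "norm d \<le> \<Delta>" "\<And>y. norm y \<le> \<Delta> \<Longrightarrow> quad H g d \<le> quad H g y"
    using continuous_attains_inf[of "cball 0 \<Delta>" "quad H g"] \<Delta> by (auto simp: mem_cball_0)
  obtain \<theta> where \<theta>: "multiplier H g d \<theta>"
    using ball_minimizer_multiplier[OF sym \<Delta> d] by blast
  define \<delta> where "\<delta> = - \<theta> - g \<bullet> d"
  have Hd: "H *v d = - g - \<theta> *\<^sub>R d" using \<theta> by (simp add: multiplier_def algebra_simps eq_neg_iff_add_eq_0)
  define c where "c = 1 / norm (stack d 1)"
  have npos: "norm (stack d 1) > 0" by (simp add: stack_eq_0_iff)
  have c: "c \<noteq> 0" using npos by (simp add: c_def stack_eq_0_iff)
  have psd: "0 \<le> w \<bullet> (H *v w) + 2 * s * (g \<bullet> w) + \<delta> * s\<^sup>2 + \<theta> * (w \<bullet> w + s\<^sup>2)" for w s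
  proof -
    \<comment> \<open>Subtracting \<open>s [d; 1]\<close>, a kernel vector, from \<open>[w; s]\<close> does not change the form and clears
      the last coordinate.\<close>
    define u where "u = w - s *\<^sub>R d"
    have w: "w = u + s *\<^sub>R d" by (simp add: u_def)
    have du: "d \<bullet> (H *v u) = - (g \<bullet> u) - \<theta> * (d \<bullet> u)"
      unfolding sym_form_commute[OF sym, of d u] by (simp add: Hd inner_diff_right inner_commute)
    have "w \<bullet> (H *v w) + 2 * s * (g \<bullet> w) + \<delta> * s\<^sup>2 + \<theta> * (w \<bullet> w + s\<^sup>2)
        = u \<bullet> (H *v u) + \<theta> * (u \<bullet> u)"
      by (simp add: w \<delta>_def matrix_vector_right_distrib matrix_vector_mult_scaleR Hd du
          inner_add_left inner_add_right inner_diff_right inner_commute power2_eq_square algebra_simps)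
    then show ?thesis using \<theta> by (simp add: multiplier_def)
  qed
  have "multiplier (ghm_matrix H g \<delta>) 0 (stack (c *\<^sub>R d) c) \<theta>"
    using psd \<theta> unfolding ghm_multiplier_stack
    by (auto simp: multiplier_def Hd matrix_vector_mult_scaleR \<delta>_def algebra_simps)
  moreover have "norm (stack (c *\<^sub>R d) c) = 1"
  proof -
    have "stack (c *\<^sub>R d) c = c *\<^sub>R stack d 1" by (simp add: stack_arith)
    then have "norm (stack (c *\<^sub>R d) c) = \<bar>c\<bar> * norm (stack d 1)" by (simp only: norm_scaleR)
    then show ?thesis using npos by (simp add: c_def)
  qed
  ultimately have "ghm_solution H g \<delta> (c *\<^sub>R d) c" by (rule ghm_solutionI)
  moreover have "trs_solution f x H g \<Delta> ((c *\<^sub>R d) /\<^sub>R c)" using d c by (simp add: trs_solution_iff)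
  ultimately show ?thesis unfolding desired_def using c by blast
qed

section \<open>Bisection\<close>

text \<open>
  The returned \<open>d\<close> has the smaller multiplier, hence is at least as long as the trust-region
  solution \<open>d\<^sub>0\<close>. It minimizes the penalized model and pays at least as much penalty as \<open>d\<^sub>0\<close>,
  so its model value is at most that of \<open>d\<^sub>0\<close>.
\<close>

lemma short_direction_above_desired:
  assumes sym: "transpose H = H" and des: "desired f x H g \<Delta> \<delta>\<^sub>0" and less: "\<delta>\<^sub>0 < \<delta>"
    and sol: "ghm_solution H g \<delta> v t" and t: "t \<noteq> 0" and short: "norm (v /\<^sub>R t) \<le> \<Delta>"
  shows "desired f x H g \<Delta> \<delta>"
proof -
  obtain v\<^sub>0 t\<^sub>0 where 0: "ghm_solution H g \<delta>\<^sub>0 v\<^sub>0 t\<^sub>0" "t\<^sub>0 \<noteq> 0" "trs_solution f x H g \<Delta> (v\<^sub>0 /\<^sub>R t\<^sub>0)"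
    using des unfolding desired_def by blast
  obtain \<theta>\<^sub>0 where m0: "multiplier (ghm_matrix H g \<delta>\<^sub>0) 0 (stack v\<^sub>0 t\<^sub>0) \<theta>\<^sub>0"
    using ghm_solution_multiplier[OF sym 0(1)] .
  obtain \<theta> where m: "multiplier (ghm_matrix H g \<delta>) 0 (stack v t) \<theta>"
    using ghm_solution_multiplier[OF sym sol] .
  define d d\<^sub>0 where "d = v /\<^sub>R t" and "d\<^sub>0 = v\<^sub>0 /\<^sub>R t\<^sub>0"
  have \<theta>: "\<theta> < \<theta>\<^sub>0" using multiplier_strict_antimono[OF m0 m t less] .
  have md: "multiplier H g d \<theta>" unfolding d_def by (rule ghm_multiplier_direction[OF m t])
  have md0: "multiplier H g d\<^sub>0 \<theta>\<^sub>0" unfolding d\<^sub>0_def by (rule ghm_multiplier_direction[OF m0 0(2)])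
  have "norm d\<^sub>0 \<le> norm d" by (rule norm_antimono_multiplier[OF sym md0 md \<theta>])
  then have "\<theta> / 2 * (norm d\<^sub>0)\<^sup>2 \<le> \<theta> / 2 * (norm d)\<^sup>2"
    using md by (intro mult_left_mono power_mono) (auto simp: multiplier_def)
  then have "quad H g d \<le> quad H g d\<^sub>0"
    using multiplier_minimizes_penalized[OF sym md, of d\<^sub>0] by linarith
  then have "trs_solution f x H g \<Delta> d"
    using 0(3) short by (force simp: trs_solution_iff d_def d\<^sub>0_def)
  then show ?thesis unfolding desired_def d_def using sol t by blast
qed

text \<open>
  Here the returned solution has the larger multiplier. A solution with \<open>t = 0\<close> would give a
  nonzero \<open>v\<close> in the kernel of \<open>H + \<theta> I\<close>, and so a negative value of the form of
  \<open>H + \<theta>\<^sub>0 I\<close>. Thus \<open>v / t\<close> exists, and it is no longer than the trust-region solution at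
  \<open>\<delta>\<^sub>0\<close>.
\<close>

lemma short_direction_below_desired:
  assumes sym: "transpose H = H" and des: "desired f x H g \<Delta> \<delta>\<^sub>0" and less: "\<delta> < \<delta>\<^sub>0"
    and sol: "ghm_solution H g \<delta> v t"
  shows "t \<noteq> 0 \<and> norm (v /\<^sub>R t) \<le> \<Delta>"
proof -
  obtain v\<^sub>0 t\<^sub>0 where 0: "ghm_solution H g \<delta>\<^sub>0 v\<^sub>0 t\<^sub>0" "t\<^sub>0 \<noteq> 0" "trs_solution f x H g \<Delta> (v\<^sub>0 /\<^sub>R t\<^sub>0)"
    using des unfolding desired_def by blast
  obtain \<theta>\<^sub>0 where m0: "multiplier (ghm_matrix H g \<delta>\<^sub>0) 0 (stack v\<^sub>0 t\<^sub>0) \<theta>\<^sub>0"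
    using ghm_solution_multiplier[OF sym 0(1)] .
  obtain \<theta> where m: "multiplier (ghm_matrix H g \<delta>) 0 (stack v t) \<theta>"
      and slack: "\<theta> = 0 \<or> norm (stack v t) = 1"
    using ghm_solution_multiplier[OF sym sol] .
  have \<theta>: "\<theta>\<^sub>0 < \<theta>" using multiplier_strict_antimono[OF m m0 0(2) less] .
  have md0: "multiplier H g (v\<^sub>0 /\<^sub>R t\<^sub>0) \<theta>\<^sub>0" by (rule ghm_multiplier_direction[OF m0 0(2)])
  have t: "t \<noteq> 0"
  proof
    assume t0: "t = 0"
    \<comment> \<open>Slackness excludes the zero vector, which is an optimal solution of a model whose minimum is 0.\<close>
    have "\<theta> \<noteq> 0" using \<theta> md0 by (auto simp: multiplier_def)
    then have "v \<noteq> 0" using slack t0 stack_eq_0_iff[of v t] by auto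
    then have "\<theta>\<^sub>0 * (v \<bullet> v) < \<theta> * (v \<bullet> v)" using \<theta> by simp
    moreover have "v \<bullet> (H *v v + \<theta> *\<^sub>R v) = 0" using m t0 by (simp add: ghm_multiplier_stack)
    moreover have "0 \<le> v \<bullet> (H *v v) + \<theta>\<^sub>0 * (v \<bullet> v)" using md0 by (simp add: multiplier_def)
    ultimately show False by (simp add: inner_add_right)
  qed
  have "norm (v /\<^sub>R t) \<le> norm (v\<^sub>0 /\<^sub>R t\<^sub>0)"
    by (rule norm_antimono_multiplier[OF sym ghm_multiplier_direction[OF m t] md0 \<theta>])
  also have "\<dots> \<le> \<Delta>" using 0(3) by (simp add: trs_solution_iff)
  finally show ?thesis using t by simp
qed

text \<open>
  The midpoint belongs to both halves, so keeping the wrong side of a desired value does no harm if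
  the midpoint is desired as well.
\<close>

lemma bisect_step_keeps_desired:
  assumes sym: "transpose H = H" and solver: "ghm_solver H g sol"
    and des: "\<exists>\<delta>\<in>{fst I..snd I}. desired f x H g \<Delta> \<delta>"
  shows "\<exists>\<delta>\<in>{fst (bisect_step sol \<Delta> I)..snd (bisect_step sol \<Delta> I)}. desired f x H g \<Delta> \<delta>"
proof -
  obtain lo hi where I: "I = (lo, hi)" by fastforce
  define \<delta> where "\<delta> = (lo + hi) / 2"
  obtain v t where vt: "sol \<delta> = (v, t)" by fastforce
  have sol: "ghm_solution H g \<delta> v t" using solver vt unfolding ghm_solver_def by (metis fst_conv snd_conv)
  obtain \<delta>\<^sub>0 where \<delta>\<^sub>0: "lo \<le> \<delta>\<^sub>0" "\<delta>\<^sub>0 \<le> hi" "desired f x H g \<Delta> \<delta>\<^sub>0" using des I by auto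
  have mid: "lo \<le> \<delta>" "\<delta> \<le> hi" using \<delta>\<^sub>0 by (auto simp: \<delta>_def)
  show ?thesis
  proof (cases "t \<noteq> 0 \<and> norm (v /\<^sub>R t) \<le> \<Delta>")
    case True
    then have step: "bisect_step sol \<Delta> I = (\<delta>, hi)"
      by (simp add: bisect_step_def I Let_def vt flip: \<delta>_def)
    show ?thesis
    proof (cases "\<delta>\<^sub>0 < \<delta>")
      case less: True
      have "desired f x H g \<Delta> \<delta>"
        using short_direction_above_desired[OF sym \<delta>\<^sub>0(3) less sol] True by blast
      then show ?thesis using mid by (auto simp: step)
    qed (use \<delta>\<^sub>0 step in force)
  next
    case False
    then have step: "bisect_step sol \<Delta> I = (lo, \<delta>)"
      by (auto simp add: bisect_step_def I Let_def vt simp flip: \<delta>_def)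
    have "\<not> \<delta> < \<delta>\<^sub>0" using short_direction_below_desired[OF sym \<delta>\<^sub>0(3) _ sol] False by blast
    then show ?thesis using \<delta>\<^sub>0 step by force
  qed
qed

lemma bracket_keeps_desired:
  assumes "transpose H = H" "ghm_solver H g sol" "\<exists>\<delta>\<in>{lo..hi}. desired f x H g \<Delta> \<delta>"
  shows "\<exists>\<delta>\<in>{fst (bracket sol \<Delta> lo hi k)..snd (bracket sol \<Delta> lo hi k)}. desired f x H g \<Delta> \<delta>"
proof (induction k)
  case 0
  then show ?case using assms(3) by (simp add: bracket_def)
next
  case (Suc k)
  then show ?case using bisect_step_keeps_desired[OF assms(1,2)] by (simp add: bracket_def)
qed

lemma bracket_length:
  "snd (bracket sol \<Delta> lo hi k) - fst (bracket sol \<Delta> lo hi k) = (hi - lo) / 2 ^ k"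
proof (induction k)
  case 0
  then show ?case by (simp add: bracket_def)
next
  case (Suc k)
  have half: "snd (bisect_step sol \<Delta> I) - fst (bisect_step sol \<Delta> I) = (snd I - fst I) / 2" for I
    by (auto simp: bisect_step_def Let_def split: prod.split) (simp_all add: field_simps)
  have "bracket sol \<Delta> lo hi (Suc k) = bisect_step sol \<Delta> (bracket sol \<Delta> lo hi k)"
    by (simp add: bracket_def)
  then show ?case using half[of "bracket sol \<Delta> lo hi k"] Suc by simp
qed

text \<open>
  If the interval is short enough from the start, no halving is needed, and the formula agrees:
  \<open>nat\<close> truncates negative logarithms, and \<open>log 2 0 = 0\<close> for an interval of length 0.
\<close>

definition bisection_bound :: "real \<Rightarrow> real \<Rightarrow> nat" where
  "bisection_bound L \<epsilon> = nat \<lceil>log 2 (L / \<epsilon>)\<rceil>"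

lemma bisection_bound_sufficient:
  assumes L: "L \<ge> 0" and \<epsilon>: "\<epsilon> > 0"
  shows "L / 2 ^ bisection_bound L \<epsilon> \<le> \<epsilon>"
proof (cases "L = 0")
  case False
  then have "L / \<epsilon> = 2 powr log 2 (L / \<epsilon>)" using L \<epsilon> by simp
  also have "\<dots> \<le> 2 powr real (bisection_bound L \<epsilon>)"
    unfolding bisection_bound_def by (intro powr_mono real_nat_ceiling_ge) simp
  also have "\<dots> = 2 ^ bisection_bound L \<epsilon>" by (simp add: powr_realpow)
  finally show ?thesis using \<epsilon> by (simp add: field_simps)
qed (use \<epsilon> in simp)

lemma bisection_bound_bigo:
  "(\<lambda>\<epsilon>. real (bisection_bound L \<epsilon>)) \<in> O[at_right 0](\<lambda>\<epsilon>. ln (1 / \<epsilon>))"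
proof (rule bigoI)
  \<comment> \<open>Below \<open>1 / e\<close> the comparison function is at least 1 and thus absorbs constants.\<close>
  have "\<forall>\<^sub>F \<epsilon> in at_right 0. \<epsilon> \<in> {0<..<exp (- 1 :: real)}"
    using eventually_at_right_real[of 0 "exp (- 1)"] by simp
  then show "\<forall>\<^sub>F \<epsilon> in at_right 0.
      norm (real (bisection_bound L \<epsilon>)) \<le> (1 + \<bar>log 2 L\<bar> + 1 / ln 2) * norm (ln (1 / \<epsilon>))"
  proof eventually_elim
    case (elim \<epsilon>)
    then have \<epsilon>: "\<epsilon> > 0" and "ln \<epsilon> < ln (exp (- 1))" by (auto simp del: ln_exp)
    then have ln: "1 \<le> ln (1 / \<epsilon>)" by (simp add: ln_div)
    have "\<bar>log 2 (L / \<epsilon>)\<bar> \<le> \<bar>log 2 L\<bar> + ln (1 / \<epsilon>) / ln 2"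
    proof (cases "L = 0")
      case True
      then show ?thesis using ln by (simp add: log_def)
    next
      case False
      then have "log 2 (L / \<epsilon>) = log 2 L + ln (1 / \<epsilon>) / ln 2"
        using \<epsilon> by (simp add: log_def ln_div diff_divide_distrib)
      then show ?thesis using ln abs_triangle_ineq[of "log 2 L" "ln (1 / \<epsilon>) / ln 2"] by simp
    qed
    moreover have "real (bisection_bound L \<epsilon>) \<le> 1 + \<bar>log 2 (L / \<epsilon>)\<bar>"
      unfolding bisection_bound_def by linarith
    moreover have "1 + \<bar>log 2 L\<bar> \<le> (1 + \<bar>log 2 L\<bar>) * ln (1 / \<epsilon>)"
      using mult_left_mono[OF ln, of "1 + \<bar>log 2 L\<bar>"] by simp
    ultimately show ?case using ln by (simp add: algebra_simps)
  qed
qed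

lemma inner_iterations_bound:
  assumes "lo \<le> hi" "\<epsilon> > 0"
  shows "inner_iterations sol \<Delta> lo hi \<epsilon> \<le> bisection_bound (hi - lo) \<epsilon>"
    and "short_enough sol \<Delta> lo hi \<epsilon> (inner_iterations sol \<Delta> lo hi \<epsilon>)"
proof -
  have "short_enough sol \<Delta> lo hi \<epsilon> (bisection_bound (hi - lo) \<epsilon>)"
    using bisection_bound_sufficient[of "hi - lo" \<epsilon>] assms by (simp add: short_enough_def bracket_length)
  then show "inner_iterations sol \<Delta> lo hi \<epsilon> \<le> bisection_bound (hi - lo) \<epsilon>"
    and "short_enough sol \<Delta> lo hi \<epsilon> (inner_iterations sol \<Delta> lo hi \<epsilon>)"
    unfolding inner_iterations_def by (auto intro: Least_le LeastI)
qed

theorem theorem2p2: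
  fixes f :: "real ^ 'n \<Rightarrow> real" and x :: "real ^ 'n"
    and H :: "real ^ 'n ^ 'n" and g :: "real ^ 'n" and \<Delta> :: real
  assumes "transpose H = H" and "\<Delta> > 0"
  shows "(\<exists>\<delta>. desired f x H g \<Delta> \<delta>) \<and>
    (\<forall>lo hi. (\<exists>\<delta>\<in>{lo..hi}. desired f x H g \<Delta> \<delta>) \<longrightarrow>
      (\<exists>N \<in> O[at_right 0](\<lambda>\<epsilon>::real. ln (1 / \<epsilon>)).
        \<forall>sol \<epsilon>. ghm_solver H g sol \<and> \<epsilon> > 0 \<longrightarrow>
          (let T = inner_iterations sol \<Delta> lo hi \<epsilon>; (a, b) = bracket sol \<Delta> lo hi T
           in real T \<le> N \<epsilon> \<and> b - a \<le> \<epsilon> \<and> (\<exists>\<delta>\<in>{a..b}. desired f x H g \<Delta> \<delta>))))"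
proof (intro conjI allI impI)
  show "\<exists>\<delta>. desired f x H g \<Delta> \<delta>" by (rule desired_exists[OF assms])
next
  fix lo hi assume des: "\<exists>\<delta>\<in>{lo..hi}. desired f x H g \<Delta> \<delta>"
  then have le: "lo \<le> hi" by auto
  show "\<exists>N \<in> O[at_right 0](\<lambda>\<epsilon>::real. ln (1 / \<epsilon>)).
        \<forall>sol \<epsilon>. ghm_solver H g sol \<and> \<epsilon> > 0 \<longrightarrow>
          (let T = inner_iterations sol \<Delta> lo hi \<epsilon>; (a, b) = bracket sol \<Delta> lo hi T
           in real T \<le> N \<epsilon> \<and> b - a \<le> \<epsilon> \<and> (\<exists>\<delta>\<in>{a..b}. desired f x H g \<Delta> \<delta>))"
  proof (intro bexI[OF _ bisection_bound_bigo[of "hi - lo"]] allI impI)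
    fix sol \<epsilon> assume "ghm_solver H g sol \<and> \<epsilon> > (0::real)"
    then show "let T = inner_iterations sol \<Delta> lo hi \<epsilon>; (a, b) = bracket sol \<Delta> lo hi T
        in real T \<le> real (bisection_bound (hi - lo) \<epsilon>) \<and> b - a \<le> \<epsilon> \<and>
           (\<exists>\<delta>\<in>{a..b}. desired f x H g \<Delta> \<delta>)"
      using inner_iterations_bound[OF le, of \<epsilon> sol \<Delta>] bracket_keeps_desired[OF assms(1) _ des]
      by (auto simp: Let_def short_enough_def case_prod_unfold)
  qed
qed

end
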